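(* Let $k\ge 2$ be an integer and let $d$ be a constant. Let $H$ be a weakly connected directed graph with $k$ source components. There exists $\varepsilon_0=\Theta_{d,k}(1)$ such that any $\varepsilon_0$-tester for $H$-freeness of $n$-vertex $d$-bounded digraphs requires at least $\Omega(n^{1-1/k})$ queries in the unidirectional model.
   Context: A digraph is $d$-bounded if both its maximum outdegree and maximum indegree are at most $d$. A digraph $H$ is weakly connected if its underlying undirected graph is connected. A strongly connected component $W$ of $H$ (a maximal vertex set inducing a strongly connected subgraph) is a source component if no edge of $H$ goes from $V(H)\setminus W$ into $W$. A digraph $G$ is $H$-free if $H$ does not appear as a subgraph of $G$. An $n$-vertex digraph $G$ is $\varepsilon$-far from $H$-freeness if more than $\varepsilon d n$ edges must be modified to obtain a $d$-bounded $H$-free digraph. An $\varepsilon$-tester for $H$-freeness is a randomized algorithm that, with probability at least $2/3$, accepts every $n$-vertex $d$-bounded $H$-free digraph and rejects every $n$-vertex $d$-bounded digraph that is $\varepsilon$-far from $H$-freeness. In the unidirectional model the algorithm may only query, for a vertex $v$ and index $i$, the $i$-th outgoing neighbor of $v$ (incoming edges cannot be queried). $\Theta_{d,k}(1)$ denotes a positive quantity depending only on $d$ and $k$ (and $H$).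
   Formalization: H is additionally assumed to be d-bounded (digraphs are finite and loopless): if H is not d-bounded, every d-bounded digraph is H-free, none is far, and the always-accepting tester with no queries refutes the claim. *)

theory Defs
  imports "HOL-Probability.Probability_Mass_Function"
begin

section \<open>Digraphs\<close>

text \<open>An n-vertex digraph: vertex set {0..<n}, edge set E, no loops (simple digraph;
  multiple edges are excluded by representing E as a set).\<close>
definition digraph_on :: "nat \<Rightarrow> (nat \<times> nat) set \<Rightarrow> bool" where
  "digraph_on n E \<longleftrightarrow> E \<subseteq> {0..<n} \<times> {0..<n} \<and> (\<forall>v. (v, v) \<notin> E)"

text \<open>d-bounded: maximum outdegree and maximum indegree at most d.\<close>
definition d_bounded :: "('a \<times> 'a) set \<Rightarrow> nat \<Rightarrow> bool" where
  "d_bounded E d \<longleftrightarrow> (\<forall>v. card {u. (v, u) \<in> E} \<le> d \<and> card {u. (u, v) \<in> E} \<le> d)"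

text \<open>H = (VH, EH) appears as a subgraph of G (edge set E on {0..<n}).\<close>
definition contains_subgraph :: "nat \<Rightarrow> (nat \<times> nat) set \<Rightarrow> 'a set \<Rightarrow> ('a \<times> 'a) set \<Rightarrow> bool" where
  "contains_subgraph n E VH EH \<longleftrightarrow>
     (\<exists>f. inj_on f VH \<and> f ` VH \<subseteq> {0..<n} \<and> (\<forall>(a, b) \<in> EH. (f a, f b) \<in> E))"

definition H_free :: "nat \<Rightarrow> (nat \<times> nat) set \<Rightarrow> 'a set \<Rightarrow> ('a \<times> 'a) set \<Rightarrow> bool" where
  "H_free n E VH EH \<longleftrightarrow> \<not> contains_subgraph n E VH EH"

text \<open>epsilon-far from H-freeness: more than eps*d*n edge modifications are needed to obtain
  a d-bounded H-free digraph on the same n vertices.\<close>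
definition eps_far :: "nat \<Rightarrow> nat \<Rightarrow> real \<Rightarrow> (nat \<times> nat) set \<Rightarrow> 'a set \<Rightarrow> ('a \<times> 'a) set \<Rightarrow> bool" where
  "eps_far n d eps E VH EH \<longleftrightarrow>
     (\<forall>E'. digraph_on n E' \<and> d_bounded E' d \<and> H_free n E' VH EH \<longrightarrow>
        real (card ((E - E') \<union> (E' - E))) > eps * real d * real n)"

section \<open>Structure of the pattern digraph H\<close>

definition weakly_connected :: "'a set \<Rightarrow> ('a \<times> 'a) set \<Rightarrow> bool" where
  "weakly_connected V E \<longleftrightarrow> V \<noteq> {} \<and> (\<forall>a\<in>V. \<forall>b\<in>V. (a, b) \<in> (E \<union> E\<inverse>)\<^sup>*)"

text \<open>W induces a strongly connected subgraph.\<close>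
definition strongly_conn_set :: "('a \<times> 'a) set \<Rightarrow> 'a set \<Rightarrow> bool" where
  "strongly_conn_set E W \<longleftrightarrow> (\<forall>a\<in>W. \<forall>b\<in>W. (a, b) \<in> (E \<inter> (W \<times> W))\<^sup>*)"

definition is_scc :: "'a set \<Rightarrow> ('a \<times> 'a) set \<Rightarrow> 'a set \<Rightarrow> bool" where
  "is_scc V E W \<longleftrightarrow> W \<noteq> {} \<and> W \<subseteq> V \<and> strongly_conn_set E W \<and>
     (\<forall>W'. W \<subseteq> W' \<and> W' \<subseteq> V \<and> strongly_conn_set E W' \<longrightarrow> W' = W)"

definition is_source_component :: "'a set \<Rightarrow> ('a \<times> 'a) set \<Rightarrow> 'a set \<Rightarrow> bool" where
  "is_source_component V E W \<longleftrightarrow> is_scc V E W \<and> (\<forall>(a, b) \<in> E. b \<in> W \<longrightarrow> a \<in> W)"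

definition num_source_components :: "'a set \<Rightarrow> ('a \<times> 'a) set \<Rightarrow> nat" where
  "num_source_components V E = card {W. is_source_component V E W}"

section \<open>Unidirectional query model\<close>

text \<open>An answer function answers a query (v, i) with the i-th outgoing neighbour of v (indices 0..d-1),
  or None if v has fewer than i+1 out-neighbours (or the query is out of range).\<close>
type_synonym qanswer = "nat \<Rightarrow> nat \<Rightarrow> nat option"

text \<open>Q is an adjacency-list representation (outgoing edges only) of the digraph E on {0..<n}.\<close>
definition represents :: "nat \<Rightarrow> nat \<Rightarrow> (nat \<times> nat) set \<Rightarrow> qanswer \<Rightarrow> bool" where
  "represents n d E Q \<longleftrightarrow>
     (\<forall>v i. v \<ge> n \<or> i \<ge> d \<longrightarrow> Q v i = None) \<and>
     (\<forall>v<n. \<exists>deg \<le> d.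
        (\<forall>i. deg \<le> i \<longrightarrow> Q v i = None) \<and>
        (\<forall>i<deg. Q v i \<noteq> None) \<and>
        inj_on (\<lambda>i. Q v i) {0..<deg} \<and>
        {u. (v, u) \<in> E} = {u. \<exists>i<deg. Q v i = Some u})"

text \<open>Deterministic adaptive query algorithms (decision trees): either output accept/reject,
  or query the i-th out-neighbour of vertex v and continue depending on the answer.\<close>
datatype qtree = Output bool | Query nat nat "nat option \<Rightarrow> qtree"

primrec run :: "qanswer \<Rightarrow> qtree \<Rightarrow> bool" where
  "run Q (Output b) = b"
| "run Q (Query v i k) = run Q (k (Q v i))"

primrec num_queries :: "qanswer \<Rightarrow> qtree \<Rightarrow> nat" where
  "num_queries Q (Output b) = 0"
| "num_queries Q (Query v i k) = Suc (num_queries Q (k (Q v i)))"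

text \<open>A randomized algorithm is a probability distribution over deterministic decision trees.
  It is an eps-tester for H-freeness of n-vertex d-bounded digraphs if, on every representation
  of every such digraph, it accepts H-free inputs and rejects eps-far inputs with probability
  at least 2/3.\<close>
definition is_tester :: "nat \<Rightarrow> nat \<Rightarrow> real \<Rightarrow> 'a set \<Rightarrow> ('a \<times> 'a) set \<Rightarrow> qtree pmf \<Rightarrow> bool" where
  "is_tester n d eps VH EH T \<longleftrightarrow>
     (\<forall>E Q. digraph_on n E \<and> d_bounded E d \<and> represents n d E Q \<longrightarrow>
        (H_free n E VH EH \<longrightarrow> measure_pmf.prob T {t. run Q t} \<ge> 2/3) \<and>
        (eps_far n d eps E VH EH \<longrightarrow> measure_pmf.prob T {t. \<not> run Q t} \<ge> 2/3))"

text \<open>The tester makes at least q queries: on some valid input and some outcome of its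
  randomness it performs at least q queries (worst-case query complexity).\<close>
definition needs_queries :: "nat \<Rightarrow> nat \<Rightarrow> qtree pmf \<Rightarrow> real \<Rightarrow> bool" where
  "needs_queries n d T q \<longleftrightarrow>
     (\<exists>t \<in> set_pmf T. \<exists>E Q. digraph_on n E \<and> d_bounded E d \<and> represents n d E Q \<and>
        real (num_queries Q t) \<ge> q)"

end

theory Submission
  imports Defs "HOL-Combinatorics.Permutations"
begin

text \<open>
  Take m gadgets, each carrying k secret bits, one for every source component of H. Inside a
  gadget there is one copy of H for every even subset Y of the source components, and the copy of
  the i-th source component keeps its edges to the core of that copy exactly when bit i agrees
  with membership of i in Y. If the bits that are 1 form an even set, the copy indexed by that
  set is a complete H; if they form an odd set, every weak component misses a source component.
  So m disjoint copies of H appear for even gadgets, and none for odd ones.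

  For every i the i-th source components of the m gadgets are shuffled by a random permutation.
  As long as each gadget has a source component that was not queried, flipping the bits of these
  components exchanges the even and the odd inputs without changing any answer. Querying into all k
  source components of some gadget is a k-fold collision among random permutations; it
  has probability at most m (q / (m - q))^k, which is small for q below c n^(1 - 1/k).
\<close>

section \<open>Decision trees querying randomly matched gadgets\<close>

primrec query_path :: "qanswer \<Rightarrow> qtree \<Rightarrow> nat list" where
  "query_path Q (Output b) = []"
| "query_path Q (Query v i c) = v # query_path Q (c (Q v i))"

lemma length_query_path: "length (query_path Q t) = num_queries Q t"
  by (induction t) auto

text \<open>Two runs can only diverge at a first step where the same vertices, the current one
  included, have been queried so far, so it suffices to compare answers under that assumption.
  Comparing whole rows \<open>Q v\<close> allows the path to forget the indices of the
  queries.\<close>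

lemma query_path_eqI:
  assumes "\<And>a. a < length (query_path Q t) \<Longrightarrow> a < length (query_path Q' t) \<Longrightarrow>
             take (Suc a) (query_path Q t) = take (Suc a) (query_path Q' t) \<Longrightarrow>
             Q (query_path Q t ! a) = Q' (query_path Q t ! a)"
  shows "query_path Q t = query_path Q' t \<and> run Q t = run Q' t"
  using assms
proof (induction t)
  case (Query v i c)
  have v: "Q v = Q' v" using Query.prems[of 0] by simp
  have "query_path Q (c (Q v i)) = query_path Q' (c (Q v i)) \<and> run Q (c (Q v i)) = run Q' (c (Q v i))"
  proof (rule Query.IH)
    fix a assume "a < length (query_path Q (c (Q v i)))" "a < length (query_path Q' (c (Q v i)))"
      "take (Suc a) (query_path Q (c (Q v i))) = take (Suc a) (query_path Q' (c (Q v i)))"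
    then show "Q (query_path Q (c (Q v i)) ! a) = Q' (query_path Q (c (Q v i)) ! a)"
      using Query.prems[of "Suc a"] v by simp
  qed simp
  then show ?case using v by simp
qed simp

section \<open>Hidden permutations and secret bits\<close>

definition matchings :: "nat \<Rightarrow> nat \<Rightarrow> (nat \<Rightarrow> nat \<Rightarrow> nat) set" where
  "matchings k m = PiE {..<k} (\<lambda>_. {p. p permutes {..<m}})"

text \<open>The row of j in \<open>R\<close> is the set of bits equal to 1 in gadget j. The value
  \<open>b = True\<close> is the even side, whose inputs will be far; \<open>b = False\<close> is
  the odd side, whose inputs will be H-free.\<close>

definition configs :: "nat \<Rightarrow> nat \<Rightarrow> bool \<Rightarrow> (nat \<times> nat) set set" where
  "configs k m b = {R. R \<subseteq> {..<m} \<times> {..<k} \<and> (\<forall>j<m. even (card (R `` {j})) = b)}"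

lemma finite_matchings: "finite (matchings k m)"
  unfolding matchings_def by (intro finite_PiE) (auto intro: finite_permutations)

lemma matchings_nonempty: "matchings k m \<noteq> {}"
  unfolding matchings_def PiE_eq_empty_iff using permutes_id by blast

lemma matchingsD: "\<sigma> \<in> matchings k m \<Longrightarrow> i < k \<Longrightarrow> \<sigma> i permutes {..<m}"
  unfolding matchings_def by (auto simp: PiE_def Pi_def)

lemma finite_configs: "finite (configs k m b)"
  unfolding configs_def by (rule finite_subset[of _ "Pow ({..<m} \<times> {..<k})"]) auto

lemma configs_nonempty: "configs k m True \<noteq> {}"
  unfolding configs_def by (auto intro!: exI[of _ "{}"])

lemma even_card_sym_diff_single:
  assumes "finite A" shows "even (card (sym_diff A {x})) \<longleftrightarrow> odd (card A)"
proof (cases "x \<in> A")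
  case True
  then have "sym_diff A {x} = A - {x}" by auto
  moreover have "card A = Suc (card (A - {x}))" using card_Suc_Diff1[OF assms True] by simp
  ultimately show ?thesis by simp
next
  case False
  then have "sym_diff A {x} = insert x A" by auto
  then show ?thesis using False assms by simp
qed

text \<open>
  Location (i, s) holds the i-th source component of gadget \<open>\<sigma> i s\<close>, and the pairs (j, i)
  in R are the bits that are set. An answer at a vertex of location (i, s) depends only on
  the gadget found there and on its bit i.
\<close>
locale hidden_matching =
  fixes k m :: nat and loc :: "nat \<Rightarrow> (nat \<times> nat) option"
    and Q :: "(nat \<Rightarrow> nat \<Rightarrow> nat) \<Rightarrow> (nat \<times> nat) set \<Rightarrow> qanswer"
  assumes k_pos: "0 < k"
    and loc_range: "loc v = Some (i, s) \<Longrightarrow> i < k \<and> s < m"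
    and Q_local: "(\<And>i s. loc v = Some (i, s) \<Longrightarrow> \<sigma> i s = \<sigma>' i s \<and> ((\<sigma> i s, i) \<in> R \<longleftrightarrow> (\<sigma> i s, i) \<in> R'))
                  \<Longrightarrow> Q \<sigma> R v = Q \<sigma>' R' v"
begin

section \<open>Flipping unqueried bits\<close>

definition touched :: "(nat \<Rightarrow> nat \<Rightarrow> nat) \<Rightarrow> (nat \<times> nat) set \<Rightarrow> qtree \<Rightarrow> (nat \<times> nat) set" where
  "touched \<sigma> R t = {(i, s). \<exists>v\<in>set (query_path (Q \<sigma> R) t). loc v = Some (i, s)}"

definition exposed :: "(nat \<Rightarrow> nat \<Rightarrow> nat) \<Rightarrow> (nat \<times> nat) set \<Rightarrow> qtree \<Rightarrow> nat \<Rightarrow> bool" where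
  "exposed \<sigma> R t j \<longleftrightarrow> (\<forall>i<k. \<exists>s. (i, s) \<in> touched \<sigma> R t \<and> \<sigma> i s = j)"

text \<open>Only \<sigma> and the touched locations enter the choice, so it survives the flip and
  \<open>flip\<close> becomes an involution. For an exposed gadget the value is arbitrary, which is
  why the lemmas on \<open>flip\<close> assume that no gadget is exposed.\<close>

definition hidden_part :: "(nat \<Rightarrow> nat \<Rightarrow> nat) \<Rightarrow> (nat \<times> nat) set \<Rightarrow> qtree \<Rightarrow> nat \<Rightarrow> nat" where
  "hidden_part \<sigma> R t j = (LEAST i. i < k \<and> \<not> (\<exists>s. (i, s) \<in> touched \<sigma> R t \<and> \<sigma> i s = j))"

definition flip :: "(nat \<Rightarrow> nat \<Rightarrow> nat) \<Rightarrow> qtree \<Rightarrow> (nat \<times> nat) set \<Rightarrow> (nat \<times> nat) set" where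
  "flip \<sigma> t R = sym_diff R ((\<lambda>j. (j, hidden_part \<sigma> R t j)) ` {..<m})"

lemma hidden_part:
  assumes "\<not> exposed \<sigma> R t j"
  shows "hidden_part \<sigma> R t j < k" "(hidden_part \<sigma> R t j, s) \<in> touched \<sigma> R t \<Longrightarrow> \<sigma> (hidden_part \<sigma> R t j) s \<noteq> j"
proof -
  have "\<exists>i. i < k \<and> \<not> (\<exists>s. (i, s) \<in> touched \<sigma> R t \<and> \<sigma> i s = j)"
    using assms by (auto simp: exposed_def)
  from LeastI_ex[OF this] show "hidden_part \<sigma> R t j < k"
    "(hidden_part \<sigma> R t j, s) \<in> touched \<sigma> R t \<Longrightarrow> \<sigma> (hidden_part \<sigma> R t j) s \<noteq> j"
    unfolding hidden_part_def[symmetric] by auto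
qed

text \<open>The flipped bit of each gadget belongs to a part whose location the original run never
  queries, so every answer of that run stays the same.\<close>

lemma flip_same_run:
  assumes "\<sigma> \<in> matchings k m" "\<forall>j<m. \<not> exposed \<sigma> R t j"
  shows "query_path (Q \<sigma> R) t = query_path (Q \<sigma> (flip \<sigma> t R)) t \<and> run (Q \<sigma> R) t = run (Q \<sigma> (flip \<sigma> t R)) t"
proof (rule query_path_eqI)
  fix a assume a: "a < length (query_path (Q \<sigma> R) t)"
  show "Q \<sigma> R (query_path (Q \<sigma> R) t ! a) = Q \<sigma> (flip \<sigma> t R) (query_path (Q \<sigma> R) t ! a)"
  proof (rule Q_local)
    fix i s assume l: "loc (query_path (Q \<sigma> R) t ! a) = Some (i, s)"
    then have T: "(i, s) \<in> touched \<sigma> R t" unfolding touched_def using a by auto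
    from loc_range[OF l] matchingsD[OF assms(1)] have "\<sigma> i s < m"
      using permutes_in_image[of "\<sigma> i" "{..<m}" s] by auto
    with assms(2) hidden_part(2)[of \<sigma> R t "\<sigma> i s" s] T
    have "hidden_part \<sigma> R t (\<sigma> i s) \<noteq> i" by auto
    then show "\<sigma> i s = \<sigma> i s \<and> ((\<sigma> i s, i) \<in> R \<longleftrightarrow> (\<sigma> i s, i) \<in> flip \<sigma> t R)"
      unfolding flip_def by auto
  qed
qed

lemma flip_touched:
  assumes "\<sigma> \<in> matchings k m" "\<forall>j<m. \<not> exposed \<sigma> R t j"
  shows "touched \<sigma> (flip \<sigma> t R) t = touched \<sigma> R t"
  using flip_same_run[OF assms] unfolding touched_def by simp

lemma flip_flip:
  assumes "\<sigma> \<in> matchings k m" "\<forall>j<m. \<not> exposed \<sigma> R t j"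
  shows "flip \<sigma> t (flip \<sigma> t R) = R"
proof -
  have "hidden_part \<sigma> (flip \<sigma> t R) t = hidden_part \<sigma> R t"
    unfolding hidden_part_def[abs_def] flip_touched[OF assms] ..
  then show ?thesis
    unfolding flip_def[of \<sigma> t "flip \<sigma> t R"] by (auto simp: flip_def)
qed

lemma flip_configs:
  assumes "\<sigma> \<in> matchings k m" "\<forall>j<m. \<not> exposed \<sigma> R t j" "R \<in> configs k m b"
  shows "flip \<sigma> t R \<in> configs k m (\<not> b)"
proof -
  have "flip \<sigma> t R \<subseteq> {..<m} \<times> {..<k}"
    using assms hidden_part(1) unfolding flip_def configs_def by fastforce
  moreover have "even (card (flip \<sigma> t R `` {j})) = (\<not> b)" if "j < m" for j
  proof -
    have "flip \<sigma> t R `` {j} = sym_diff (R `` {j}) {hidden_part \<sigma> R t j}"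
      using that unfolding flip_def by auto
    moreover have "R `` {j} \<subseteq> {..<k}"
      using assms(3) unfolding configs_def by blast
    then have "finite (R `` {j})" by (rule finite_subset) simp
    moreover have "even (card (R `` {j})) = b"
      using assms(3) that unfolding configs_def by blast
    ultimately show ?thesis by (simp only: even_card_sym_diff_single)
  qed
  ultimately show ?thesis unfolding configs_def by auto
qed

lemma card_unexposed_le:
  assumes "\<sigma> \<in> matchings k m"
  shows "card {R \<in> configs k m b. run (Q \<sigma> R) t \<and> (\<forall>j<m. \<not> exposed \<sigma> R t j)}
       \<le> card {R \<in> configs k m (\<not> b). run (Q \<sigma> R) t}"
proof (rule card_inj_on_le[of "flip \<sigma> t"])
  show "inj_on (flip \<sigma> t) {R \<in> configs k m b. run (Q \<sigma> R) t \<and> (\<forall>j<m. \<not> exposed \<sigma> R t j)}"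
    by (rule inj_on_inverseI[of _ "flip \<sigma> t"]) (use flip_flip[OF assms] in auto)
  show "flip \<sigma> t ` {R \<in> configs k m b. run (Q \<sigma> R) t \<and> (\<forall>j<m. \<not> exposed \<sigma> R t j)}
    \<subseteq> {R \<in> configs k m (\<not> b). run (Q \<sigma> R) t}"
    using flip_configs[OF assms] flip_same_run[OF assms] by auto
qed (simp add: finite_configs)

lemma card_configs_eq: "card (configs k m b) = card (configs k m (\<not> b))"
proof -
  obtain \<sigma> where \<sigma>: "\<sigma> \<in> matchings k m" using matchings_nonempty by auto
  \<comment> \<open>A tree without queries accepts everything and exposes no gadget, since k > 0, so
    \<open>card_unexposed_le\<close> compares all configurations.\<close>
  have "\<not> exposed \<sigma> R (Output True) j" for R j
    using k_pos by (auto simp: exposed_def touched_def)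
  then have "card (configs k m b) \<le> card (configs k m (\<not> b))" for b
    using card_unexposed_le[OF \<sigma>, of b "Output True"] by simp
  from this[of b] this[of "\<not> b"] show ?thesis by simp
qed

section \<open>Counting the matchings that expose a gadget\<close>

text \<open>
  An encoding argument: pulling every source component of gadget j to a location that was never
  queried, and remembering the times at which they were first hit, loses no information. Indeed,
  the original run can be replayed from the modified permutations by answering j at these times.
\<close>
lemma card_exposed_le:
  assumes len: "\<And>\<sigma>. \<sigma> \<in> matchings k m \<Longrightarrow> num_queries (Q \<sigma> R) t \<le> q" and "j < m"
  shows "card {\<sigma> \<in> matchings k m. exposed \<sigma> R t j} * (m - q) ^ k \<le> card (matchings k m) * q ^ k"
proof -
  define B where "B = {\<sigma> \<in> matchings k m. exposed \<sigma> R t j}"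
  define path where "path \<sigma> = query_path (Q \<sigma> R) t" for \<sigma>
  define h where "h \<sigma> i = inv (\<sigma> i) j" for \<sigma> :: "nat \<Rightarrow> nat \<Rightarrow> nat" and i
  define hit where "hit \<sigma> i = (LEAST a. a < length (path \<sigma>) \<and> loc (path \<sigma> ! a) = Some (i, h \<sigma> i))" for \<sigma> i
  define U where "U \<sigma> = PiE {..<k} (\<lambda>i. {..<m} - {s. (i, s) \<in> touched \<sigma> R t})" for \<sigma>
  \<comment> \<open>Composing with the transposition moves j to the untouched location
    \<open>u i\<close>. Each \<sigma> has at least (m - q)^k choices of u, and the codomain has
    \<open>card (matchings k m) * q ^ k\<close> elements, so injectivity gives the claim.\<close>
  define enc where "enc = (\<lambda>(\<sigma>, u). (restrict (\<lambda>i. \<sigma> i \<circ> Transposition.transpose (h \<sigma> i) (u i)) {..<k}, restrict (hit \<sigma>) {..<k}))"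
  have fB: "finite B" unfolding B_def using finite_matchings by auto
  have perm: "\<sigma> i permutes {..<m}" if "\<sigma> \<in> B" "i < k" for \<sigma> i
    using that matchingsD unfolding B_def by auto
  have h: "\<sigma> i s = j \<longleftrightarrow> s = h \<sigma> i" if "\<sigma> \<in> B" "i < k" for \<sigma> i s
    using permutes_inverses[OF perm[OF that]] unfolding h_def by metis
  have hm: "h \<sigma> i < m" if "\<sigma> \<in> B" "i < k" for \<sigma> i
    using permutes_in_image[OF permutes_inv[OF perm[OF that]], of j] \<open>j < m\<close> unfolding h_def by auto
  have lenB: "length (path \<sigma>) \<le> q" if "\<sigma> \<in> B" for \<sigma>
    using len that unfolding B_def path_def length_query_path by auto
  have hit_ex: "\<exists>a. a < length (path \<sigma>) \<and> loc (path \<sigma> ! a) = Some (i, h \<sigma> i)" if B: "\<sigma> \<in> B" "i < k" for \<sigma> i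
  proof -
    obtain s where "(i, s) \<in> touched \<sigma> R t" "\<sigma> i s = j"
      using B unfolding B_def exposed_def by blast
    then have "(i, h \<sigma> i) \<in> touched \<sigma> R t" using h[OF B] by auto
    then show ?thesis unfolding touched_def path_def by (auto simp: in_set_conv_nth)
  qed
  have hit: "hit \<sigma> i < length (path \<sigma>)" "loc (path \<sigma> ! hit \<sigma> i) = Some (i, h \<sigma> i)" if "\<sigma> \<in> B" "i < k" for \<sigma> i
    using LeastI_ex[OF hit_ex[OF that]] unfolding hit_def by auto
  have hit_le: "hit \<sigma> i \<le> a" if "a < length (path \<sigma>)" "loc (path \<sigma> ! a) = Some (i, h \<sigma> i)" for \<sigma> i a
    unfolding hit_def using that by (auto intro: Least_le)
  have "inj_on enc (Sigma B U)"
  proof (rule inj_onI, clarify)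
    fix \<sigma> u \<rho> w assume A: "\<sigma> \<in> B" "u \<in> U \<sigma>" "\<rho> \<in> B" "w \<in> U \<rho>" "enc (\<sigma>, u) = enc (\<rho>, w)"
    have enc1: "fst (enc (\<sigma>, u)) = fst (enc (\<rho>, w))" and enc2: "snd (enc (\<sigma>, u)) = snd (enc (\<rho>, w))"
      using A(5) by simp_all
    have sw: "\<sigma> i \<circ> Transposition.transpose (h \<sigma> i) (u i) = \<rho> i \<circ> Transposition.transpose (h \<rho> i) (w i)" if "i < k" for i
      using fun_cong[OF enc1, of i] that unfolding enc_def by simp
    have ht: "hit \<sigma> i = hit \<rho> i" if "i < k" for i
      using fun_cong[OF enc2, of i] that unfolding enc_def by simp
    have U: "(i, u i) \<notin> touched \<sigma> R t" "(i, w i) \<notin> touched \<rho> R t" if "i < k" for i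
      using A(2,4) that unfolding U_def by auto
    have "path \<sigma> = path \<rho> \<and> run (Q \<sigma> R) t = run (Q \<rho> R) t"
      unfolding path_def
    proof (rule query_path_eqI, unfold path_def[symmetric])
      fix a assume a: "a < length (path \<sigma>)" "a < length (path \<rho>)" "take (Suc a) (path \<sigma>) = take (Suc a) (path \<rho>)"
      have eq: "path \<sigma> ! b = path \<rho> ! b" if "b \<le> a" for b
        using arg_cong[OF a(3), of "\<lambda>xs. xs ! b"] that by simp
      show "Q \<sigma> R (path \<sigma> ! a) = Q \<rho> R (path \<sigma> ! a)"
      proof (rule Q_local)
        fix i s assume l: "loc (path \<sigma> ! a) = Some (i, s)"
        have l': "loc (path \<rho> ! a) = Some (i, s)" using l eq[of a] by simp
        have i: "i < k" using loc_range[OF l] by auto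
        have T: "(i, s) \<in> touched \<sigma> R t" "(i, s) \<in> touched \<rho> R t"
          using l l' a unfolding touched_def path_def by (auto intro!: bexI[OF _ nth_mem])
        \<comment> \<open>Queried locations are touched while \<open>u i\<close> and
          \<open>w i\<close> are not, so away from the location of j the transpositions fix
          s.\<close>
        have su: "s \<noteq> u i" "s \<noteq> w i" using T U[OF i] by auto
        \<comment> \<open>Both runs have queried the same vertices up to time a. If the common hit
          time is at most a, this forces the two locations of j to agree; if it is later, then s is
          neither of them.\<close>
        have same: "h \<sigma> i = h \<rho> i" if "hit \<sigma> i \<le> a"
          using hit(2)[OF A(1) i] hit(2)[OF A(3) i] ht[OF i] eq[OF that] by simp
        have iff: "s = h \<sigma> i \<longleftrightarrow> s = h \<rho> i"
          using same hit_le[OF a(1), of i] hit_le[OF a(2), of i] l l' ht[OF i] by auto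
        have "\<sigma> i s = \<rho> i s"
        proof (cases "s = h \<sigma> i")
          case True
          then show ?thesis using iff h[OF A(1) i, of s] h[OF A(3) i, of s] by simp
        next
          case False
          then show ?thesis using iff su fun_cong[OF sw[OF i], of s] by (simp add: Transposition.transpose_def)
        qed
        then show "\<sigma> i s = \<rho> i s \<and> ((\<sigma> i s, i) \<in> R \<longleftrightarrow> (\<sigma> i s, i) \<in> R)" by simp
      qed
    qed
    then have path_eq: "path \<sigma> = path \<rho>" by simp
    have hh: "h \<sigma> i = h \<rho> i" if "i < k" for i
      using hit(2)[OF A(1) that] hit(2)[OF A(3) that] ht[OF that] path_eq by simp
    \<comment> \<open>In the encoded permutation the preimage of j is \<open>u i\<close>; for the
      other pair it is \<open>w i\<close>.\<close>
    have uw: "u i = w i" if i: "i < k" for i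
    proof -
      have "\<rho> i (Transposition.transpose (h \<rho> i) (w i) (u i)) = \<sigma> i (h \<sigma> i)"
        using fun_cong[OF sw[OF i], of "u i"] by simp
      also have "\<dots> = j" using h[OF A(1) i] by simp
      finally have "Transposition.transpose (h \<rho> i) (w i) (u i) = h \<rho> i" using h[OF A(3) i] by simp
      then show ?thesis by (metis transpose_apply_second transpose_involutory)
    qed
    have "\<sigma> i = \<rho> i" if "i < k" for i
      using sw[OF that] hh[OF that] uw[OF that]
      by (metis comp_assoc comp_id transpose_comp_involutory)
    then have "\<sigma> = \<rho>" using A(1,3) unfolding B_def matchings_def by (intro PiE_ext[of \<sigma> "{..<k}"]) auto
    moreover have "u = w" using A(2,4) uw unfolding U_def by (intro PiE_ext[of u "{..<k}"]) auto
    ultimately show "\<sigma> = \<rho> \<and> u = w" by simp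
  qed
  moreover have "enc ` Sigma B U \<subseteq> matchings k m \<times> PiE {..<k} (\<lambda>_. {..<q})"
  proof (rule image_subsetI, clarify)
    fix \<sigma> u assume A: "\<sigma> \<in> B" "u \<in> U \<sigma>"
    have "\<sigma> i \<circ> Transposition.transpose (h \<sigma> i) (u i) permutes {..<m}" if "i < k" for i
      using hm[OF A(1) that] A(2) that perm[OF A(1) that] unfolding U_def
      by (intro permutes_compose permutes_swap_id) auto
    moreover have "hit \<sigma> i < q" if "i < k" for i
      using hit(1)[OF A(1) that] lenB[OF A(1)] by simp
    ultimately show "enc (\<sigma>, u) \<in> matchings k m \<times> PiE {..<k} (\<lambda>_. {..<q})"
      unfolding enc_def matchings_def by auto
  qed
  moreover have "finite (matchings k m \<times> PiE {..<k} (\<lambda>_. {..<q}))"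
    by (intro finite_cartesian_product finite_matchings finite_PiE) auto
  ultimately have "card (Sigma B U) \<le> card (matchings k m \<times> PiE {..<k} (\<lambda>_. {..<q}))"
    by (rule card_inj_on_le)
  also have "\<dots> = card (matchings k m) * q ^ k"
    by (simp add: card_cartesian_product card_PiE)
  finally have upper: "card (Sigma B U) \<le> card (matchings k m) * q ^ k" .
  have "(m - q) ^ k \<le> card (U \<sigma>)" if \<sigma>: "\<sigma> \<in> B" for \<sigma>
  proof -
    have "m - q \<le> card ({..<m} - {s. (i, s) \<in> touched \<sigma> R t})" for i
    proof -
      have sub: "{s. (i, s) \<in> touched \<sigma> R t} \<subseteq> (\<lambda>v. snd (the (loc v))) ` set (path \<sigma>)"
        unfolding touched_def path_def by force
      then have f: "finite {s. (i, s) \<in> touched \<sigma> R t}" by (rule finite_subset) simp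
      have "card {s. (i, s) \<in> touched \<sigma> R t} \<le> card (set (path \<sigma>))"
        using card_mono[OF _ sub] card_image_le[of "set (path \<sigma>)"] by (meson List.finite_set finite_imageI le_trans)
      also have "\<dots> \<le> q" using card_length[of "path \<sigma>"] lenB[OF \<sigma>] by simp
      finally show ?thesis using diff_card_le_card_Diff[OF f, of "{..<m}"] by simp
    qed
    then have "(\<Prod>i<k. m - q) \<le> (\<Prod>i<k. card ({..<m} - {s. (i, s) \<in> touched \<sigma> R t}))"
      by (intro prod_mono) auto
    then show ?thesis unfolding U_def by (simp add: card_PiE)
  qed
  then have "card B * (m - q) ^ k \<le> (\<Sum>\<sigma>\<in>B. card (U \<sigma>))"
    using sum_mono[of B "\<lambda>_. (m - q) ^ k"] by simp
  also have "\<dots> = card (Sigma B U)"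
    using fB by (subst card_SigmaI) (auto simp: U_def intro!: finite_PiE)
  finally show ?thesis using upper unfolding B_def by simp
qed

section \<open>Averaging over inputs and trees\<close>

lemma acceptance_diff_le:
  assumes q: "\<And>\<sigma> R. \<sigma> \<in> matchings k m \<Longrightarrow> R \<in> configs k m False \<Longrightarrow> num_queries (Q \<sigma> R) t \<le> q"
  shows "((\<Sum>\<sigma>\<in>matchings k m. card {R \<in> configs k m False. run (Q \<sigma> R) t})
          - (\<Sum>\<sigma>\<in>matchings k m. card {R \<in> configs k m True. run (Q \<sigma> R) t})) * (m - q) ^ k
       \<le> card (configs k m False) * (m * (card (matchings k m) * q ^ k))"
proof -
  define M where "M = matchings k m"
  define C where "C = configs k m False"
  have fin: "finite M" "finite C" unfolding M_def C_def by (simp_all add: finite_matchings finite_configs)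
  have "card {R \<in> C. run (Q \<sigma> R) t}
      \<le> card {R \<in> configs k m True. run (Q \<sigma> R) t} + (\<Sum>R\<in>C. \<Sum>j<m. of_bool (exposed \<sigma> R t j))"
    if "\<sigma> \<in> M" for \<sigma>
  proof -
    \<comment> \<open>An accepted odd input either exposes no gadget, and then flips to an accepted
      even input, or exposes some gadget and is charged to a union bound over the gadgets.\<close>
    have "{R \<in> C. run (Q \<sigma> R) t} \<subseteq> {R \<in> C. run (Q \<sigma> R) t \<and> (\<forall>j<m. \<not> exposed \<sigma> R t j)} \<union> {R \<in> C. \<exists>j<m. exposed \<sigma> R t j}"
      by auto
    then have "card {R \<in> C. run (Q \<sigma> R) t}
        \<le> card ({R \<in> C. run (Q \<sigma> R) t \<and> (\<forall>j<m. \<not> exposed \<sigma> R t j)} \<union> {R \<in> C. \<exists>j<m. exposed \<sigma> R t j})"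
      using fin by (intro card_mono) auto
    also have "\<dots> \<le> card {R \<in> C. run (Q \<sigma> R) t \<and> (\<forall>j<m. \<not> exposed \<sigma> R t j)} + card {R \<in> C. \<exists>j<m. exposed \<sigma> R t j}"
      by (rule card_Un_le)
    also have "card {R \<in> C. run (Q \<sigma> R) t \<and> (\<forall>j<m. \<not> exposed \<sigma> R t j)} \<le> card {R \<in> configs k m True. run (Q \<sigma> R) t}"
      using card_unexposed_le[of \<sigma> False t] that unfolding C_def M_def by simp
    also have "card {R \<in> C. \<exists>j<m. exposed \<sigma> R t j} = (\<Sum>R\<in>C. of_bool (\<exists>j<m. exposed \<sigma> R t j))"
      using fin by (simp add: sum.If_cases of_bool_def Int_def)
    also have "\<dots> \<le> (\<Sum>R\<in>C. \<Sum>j<m. of_bool (exposed \<sigma> R t j))"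
    proof (rule sum_mono)
      fix R
      show "(of_bool (\<exists>j<m. exposed \<sigma> R t j) :: nat) \<le> (\<Sum>j<m. of_bool (exposed \<sigma> R t j))"
      proof (cases "\<exists>j<m. exposed \<sigma> R t j")
        case True
        then obtain j where "j < m" "exposed \<sigma> R t j" by blast
        then show ?thesis using member_le_sum[of j "{..<m}" "\<lambda>j. of_bool (exposed \<sigma> R t j) :: nat"] by simp
      qed simp
    qed
    finally show ?thesis by simp
  qed
  then have "(\<Sum>\<sigma>\<in>M. card {R \<in> C. run (Q \<sigma> R) t})
      \<le> (\<Sum>\<sigma>\<in>M. card {R \<in> configs k m True. run (Q \<sigma> R) t} + (\<Sum>R\<in>C. \<Sum>j<m. of_bool (exposed \<sigma> R t j)))"
    by (rule sum_mono)
  then have "((\<Sum>\<sigma>\<in>M. card {R \<in> C. run (Q \<sigma> R) t}) - (\<Sum>\<sigma>\<in>M. card {R \<in> configs k m True. run (Q \<sigma> R) t}))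
      \<le> (\<Sum>\<sigma>\<in>M. \<Sum>R\<in>C. \<Sum>j<m. of_bool (exposed \<sigma> R t j))"
    by (simp add: sum.distrib)
  \<comment> \<open>Flipping works with a fixed matching, whereas the encoding bound counts
    matchings for a fixed configuration; hence the exchange of sums.\<close>
  also have "\<dots> = (\<Sum>R\<in>C. \<Sum>\<sigma>\<in>M. \<Sum>j<m. of_bool (exposed \<sigma> R t j))"
    by (rule sum.swap)
  also have "\<dots> = (\<Sum>R\<in>C. \<Sum>j<m. \<Sum>\<sigma>\<in>M. of_bool (exposed \<sigma> R t j))"
    by (intro sum.cong refl sum.swap)
  also have "\<dots> = (\<Sum>R\<in>C. \<Sum>j<m. card {\<sigma> \<in> M. exposed \<sigma> R t j})"
    using fin by (simp add: sum.If_cases of_bool_def Int_def)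
  finally have "((\<Sum>\<sigma>\<in>M. card {R \<in> C. run (Q \<sigma> R) t}) - (\<Sum>\<sigma>\<in>M. card {R \<in> configs k m True. run (Q \<sigma> R) t})) * (m - q) ^ k
      \<le> (\<Sum>R\<in>C. \<Sum>j<m. card {\<sigma> \<in> M. exposed \<sigma> R t j}) * (m - q) ^ k"
    by (rule mult_right_mono) simp
  also have "\<dots> = (\<Sum>R\<in>C. \<Sum>j<m. card {\<sigma> \<in> M. exposed \<sigma> R t j} * (m - q) ^ k)"
    by (simp add: sum_distrib_right)
  also have "\<dots> \<le> (\<Sum>R\<in>C. \<Sum>j<m. card M * q ^ k)"
    unfolding M_def C_def by (intro sum_mono card_exposed_le q) auto
  finally show ?thesis unfolding M_def C_def by simp
qed

text \<open>In expectation at least 2/3 of the odd inputs and at most 1/3 of the even inputs are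
  accepted. Both sides have the same size N, so the expected gap is at least N/3, while
  \<open>acceptance_diff_le\<close> bounds the gap for each tree in the support.\<close>

lemma tester_queries_ge:
  fixes T :: "qtree pmf"
  assumes rej: "\<And>\<sigma> R. \<sigma> \<in> matchings k m \<Longrightarrow> R \<in> configs k m True \<Longrightarrow> measure_pmf.prob T {t. \<not> run (Q \<sigma> R) t} \<ge> 2/3"
    and acc: "\<And>\<sigma> R. \<sigma> \<in> matchings k m \<Longrightarrow> R \<in> configs k m False \<Longrightarrow> measure_pmf.prob T {t. run (Q \<sigma> R) t} \<ge> 2/3"
    and q: "\<And>t \<sigma> R. t \<in> set_pmf T \<Longrightarrow> \<sigma> \<in> matchings k m \<Longrightarrow> R \<in> configs k m False \<Longrightarrow> num_queries (Q \<sigma> R) t \<le> q"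
  shows "real (m - q) ^ k \<le> 3 * real m * real q ^ k"
proof -
  define N where "N = real (card (matchings k m)) * real (card (configs k m False))"
  define A where "A b t = (\<Sum>\<sigma>\<in>matchings k m. \<Sum>R\<in>configs k m b. indicator {t. run (Q \<sigma> R) t} t :: real)" for b t
  have A_eq: "A b t = real (\<Sum>\<sigma>\<in>matchings k m. card {R \<in> configs k m b. run (Q \<sigma> R) t})" for b t
    unfolding A_def using finite_configs[of k m b]
    by (simp add: indicator_def sum.If_cases Int_def)
  have A_int: "integrable (measure_pmf T) (A b)" for b
    unfolding A_def by (intro Bochner_Integration.integrable_sum) (simp add: measure_pmf.emeasure_finite less_top[symmetric])
  have A_exp: "measure_pmf.expectation T (A b) = (\<Sum>\<sigma>\<in>matchings k m. \<Sum>R\<in>configs k m b. measure_pmf.prob T {t. run (Q \<sigma> R) t})" for b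
    unfolding A_def by (subst Bochner_Integration.integral_sum | intro sum.cong refl | simp add: measure_pmf.emeasure_finite less_top[symmetric])+
  have card_eq: "card (configs k m True) = card (configs k m False)" using card_configs_eq[of True] by simp
  have "0 < card (configs k m True)" using configs_nonempty finite_configs card_gt_0_iff by blast
  then have N: "N > 0" unfolding N_def
    using card_eq matchings_nonempty finite_matchings by (simp add: card_gt_0_iff)
  have "(\<Sum>\<sigma>\<in>matchings k m. \<Sum>R\<in>configs k m False. 2/3) \<le> measure_pmf.expectation T (A False)"
    unfolding A_exp by (intro sum_mono acc)
  then have lo: "2/3 * N \<le> measure_pmf.expectation T (A False)" unfolding N_def by simp
  have "measure_pmf.prob T {t. run (Q \<sigma> R) t} \<le> 1/3" if "\<sigma> \<in> matchings k m" "R \<in> configs k m True" for \<sigma> R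
  proof -
    have "measure_pmf.prob T {t. run (Q \<sigma> R) t} = 1 - measure_pmf.prob T {t. \<not> run (Q \<sigma> R) t}"
      using measure_pmf.prob_compl[of "{t. \<not> run (Q \<sigma> R) t}" T] by (simp add: Compl_eq_Diff_UNIV[symmetric] Collect_neg_eq[symmetric])
    then show ?thesis using rej[OF that] by simp
  qed
  then have "measure_pmf.expectation T (A True) \<le> (\<Sum>\<sigma>\<in>matchings k m. \<Sum>R\<in>configs k m True. 1/3)"
    unfolding A_exp by (intro sum_mono)
  then have hi: "measure_pmf.expectation T (A True) \<le> 1/3 * N" unfolding N_def using card_eq by simp
  have diff: "(A False t - A True t) * real (m - q) ^ k \<le> N * (real m * real q ^ k)" if "t \<in> set_pmf T" for t
  proof -
    have "A False t - A True t \<le> real ((\<Sum>\<sigma>\<in>matchings k m. card {R \<in> configs k m False. run (Q \<sigma> R) t})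
          - (\<Sum>\<sigma>\<in>matchings k m. card {R \<in> configs k m True. run (Q \<sigma> R) t}))"
      unfolding A_eq by linarith
    then have "(A False t - A True t) * real (m - q) ^ k \<le> real (((\<Sum>\<sigma>\<in>matchings k m. card {R \<in> configs k m False. run (Q \<sigma> R) t})
          - (\<Sum>\<sigma>\<in>matchings k m. card {R \<in> configs k m True. run (Q \<sigma> R) t})) * (m - q) ^ k)"
      unfolding of_nat_mult of_nat_power by (rule mult_right_mono) simp
    also have "\<dots> \<le> real (card (configs k m False) * (m * (card (matchings k m) * q ^ k)))"
      using acceptance_diff_le[of t q] q[OF that] by (intro of_nat_mono) blast
    finally show ?thesis unfolding N_def by (simp add: mult_ac)
  qed
  have "N * (1/3 * real (m - q) ^ k) \<le> (measure_pmf.expectation T (A False) - measure_pmf.expectation T (A True)) * real (m - q) ^ k"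
    using mult_right_mono[of "1/3 * N" "measure_pmf.expectation T (A False) - measure_pmf.expectation T (A True)" "real (m - q) ^ k"] lo hi by (simp add: mult_ac)
  also have "\<dots> = measure_pmf.expectation T (\<lambda>t. (A False t - A True t) * real (m - q) ^ k)"
    using A_int by simp
  also have "\<dots> \<le> measure_pmf.expectation T (\<lambda>t. N * (real m * real q ^ k))"
    using A_int by (intro integral_mono_AE) (auto simp: AE_measure_pmf_iff diff)
  finally have "N * (1/3 * real (m - q) ^ k) \<le> N * (real m * real q ^ k)" by simp
  then show ?thesis using N by simp
qed

end

section \<open>The gadget digraph\<close>

definition adj_list :: "(nat \<times> nat) set \<Rightarrow> qanswer" where
  "adj_list E v i = (let xs = sorted_list_of_set (E `` {v}) in if i < length xs then Some (xs ! i) else None)"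

lemma represents_adj_list:
  assumes "digraph_on n E" "d_bounded E d"
  shows "represents n d E (adj_list E)"
proof -
  have sub: "E `` {v} \<subseteq> {0..<n}" for v using assms(1) unfolding digraph_on_def by auto
  have fin: "finite (E `` {v})" for v using finite_subset[OF sub] by simp
  have nbrs: "{u. (v, u) \<in> E} = E `` {v}" for v by auto
  have len: "length (sorted_list_of_set (E `` {v})) \<le> d" for v
    using assms(2) unfolding d_bounded_def nbrs by simp
  have "adj_list E v i = None" if "v \<ge> n \<or> i \<ge> d" for v i
    using that
  proof
    assume "v \<ge> n"
    then have "E `` {v} = {}" using assms(1) unfolding digraph_on_def by auto
    then show ?thesis unfolding adj_list_def by simp
  next
    assume "i \<ge> d"
    then show ?thesis using len[of v] unfolding adj_list_def by (simp add: Let_def)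
  qed
  moreover have "\<exists>deg\<le>d. (\<forall>i. deg \<le> i \<longrightarrow> adj_list E v i = None) \<and> (\<forall>i<deg. adj_list E v i \<noteq> None) \<and>
        inj_on (\<lambda>i. adj_list E v i) {0..<deg} \<and> {u. (v, u) \<in> E} = {u. \<exists>i<deg. adj_list E v i = Some u}" for v
  proof (intro exI[of _ "length (sorted_list_of_set (E `` {v}))"] conjI)
    show "inj_on (\<lambda>i. adj_list E v i) {0..<length (sorted_list_of_set (E `` {v}))}"
      unfolding adj_list_def Let_def by (auto intro!: inj_onI simp: nth_eq_iff_index_eq)
    have "E `` {v} = set (sorted_list_of_set (E `` {v}))" using fin by simp
    also have "\<dots> = {u. \<exists>i<length (sorted_list_of_set (E `` {v})). adj_list E v i = Some u}"
      unfolding set_conv_nth adj_list_def Let_def by (auto simp del: length_sorted_list_of_set)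
    finally show "{u. (v, u) \<in> E} = {u. \<exists>i<length (sorted_list_of_set (E `` {v})). adj_list E v i = Some u}"
      unfolding nbrs .
  qed (use len in \<open>auto simp: adj_list_def Let_def\<close>)
  ultimately show ?thesis unfolding represents_def by blast
qed

section \<open>The digraph built from m gadgets\<close>

definition even_subsets :: "nat \<Rightarrow> nat set set" where
  "even_subsets k = {Y. Y \<subseteq> {..<k} \<and> even (card Y)}"

text \<open>
  The value i < k of \<open>part\<close> stands for the i-th source component, and k for the core.
\<close>
locale gadget_digraph =
  fixes VH :: "'a set" and EH :: "('a \<times> 'a) set" and part :: "'a \<Rightarrow> nat" and k d m n :: nat
    and lab :: "'a \<times> nat \<times> nat set \<Rightarrow> nat"
  assumes k_ge: "2 \<le> k" and finite_VH: "finite VH" and EH_sub: "EH \<subseteq> VH \<times> VH"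
    and EH_irrefl: "(a, a) \<notin> EH" and EH_bounded: "d_bounded EH d"
    and connected: "weakly_connected VH EH"
    and part_edge: "(u, v) \<in> EH \<Longrightarrow> part u \<noteq> part v \<Longrightarrow> part u < k \<and> part v = k"
    and part_surj: "i < k \<Longrightarrow> \<exists>u\<in>VH. part u = i"
    and lab_inj: "inj_on lab (VH \<times> {..<m} \<times> even_subsets k)"
    and lab_range: "lab ` (VH \<times> {..<m} \<times> even_subsets k) \<subseteq> {0..<n}"
begin

text \<open>In \<open>lab (u, s, Y)\<close> the index s is a location if u lies in a source
  component and a gadget if u lies in the core. An edge from a source component to the core
  translates the one into the other; Y names the copy of H and never changes along an edge.\<close>

definition target :: "(nat \<Rightarrow> nat \<Rightarrow> nat) \<Rightarrow> 'a \<Rightarrow> 'a \<Rightarrow> nat \<Rightarrow> nat" where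
  "target \<sigma> u v s = (if part u = part v then s else \<sigma> (part u) s)"

definition attached :: "(nat \<Rightarrow> nat \<Rightarrow> nat) \<Rightarrow> (nat \<times> nat) set \<Rightarrow> 'a \<Rightarrow> nat \<Rightarrow> nat set \<Rightarrow> bool" where
  "attached \<sigma> R u s Y \<longleftrightarrow> (part u \<in> Y \<longleftrightarrow> (\<sigma> (part u) s, part u) \<in> R)"

definition edges :: "(nat \<Rightarrow> nat \<Rightarrow> nat) \<Rightarrow> (nat \<times> nat) set \<Rightarrow> (nat \<times> nat) set" where
  "edges \<sigma> R = {(lab (u, s, Y), lab (v, target \<sigma> u v s, Y)) | u v s Y.
     (u, v) \<in> EH \<and> s < m \<and> Y \<in> even_subsets k \<and> (part u \<noteq> part v \<longrightarrow> attached \<sigma> R u s Y)}"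

lemma lab_eq_iff:
  assumes "u \<in> VH" "s < m" "Y \<in> even_subsets k" "u' \<in> VH" "s' < m" "Y' \<in> even_subsets k"
  shows "lab (u, s, Y) = lab (u', s', Y') \<longleftrightarrow> u = u' \<and> s = s' \<and> Y = Y'"
  using inj_on_eq_iff[OF lab_inj, of "(u, s, Y)" "(u', s', Y')"] assms by auto

lemma EH_D: "(u, v) \<in> EH \<Longrightarrow> u \<in> VH \<and> v \<in> VH"
  using EH_sub by auto

lemma target_less:
  assumes "\<sigma> \<in> matchings k m" "(u, v) \<in> EH" "s < m"
  shows "target \<sigma> u v s < m"
  using part_edge[OF assms(2)] matchingsD[OF assms(1), of "part u"] permutes_in_image[of "\<sigma> (part u)" "{..<m}" s] assms(3)
  unfolding target_def by auto

lemma edges_nbrs: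
  assumes "u \<in> VH" "s < m" "Y \<in> even_subsets k"
  shows "edges \<sigma> R `` {lab (u, s, Y)} =
    (\<lambda>v. lab (v, target \<sigma> u v s, Y)) ` {v. (u, v) \<in> EH \<and> (part u \<noteq> part v \<longrightarrow> attached \<sigma> R u s Y)}"
    (is "?L = ?R")
proof
  show "?L \<subseteq> ?R"
  proof
    fix y assume "y \<in> ?L"
    then obtain u' v s' Y' where A: "lab (u, s, Y) = lab (u', s', Y')" "y = lab (v, target \<sigma> u' v s', Y')"
      "(u', v) \<in> EH" "s' < m" "Y' \<in> even_subsets k" "part u' \<noteq> part v \<longrightarrow> attached \<sigma> R u' s' Y'"
      unfolding edges_def by auto
    then have "u = u' \<and> s = s' \<and> Y = Y'" using lab_eq_iff[OF assms] EH_D by blast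
    then show "y \<in> ?R" using A by auto
  qed
  show "?R \<subseteq> ?L" using assms unfolding edges_def by blast
qed

lemma digraph_on_edges:
  assumes "\<sigma> \<in> matchings k m"
  shows "digraph_on n (edges \<sigma> R)"
proof -
  have *: "lab (u, s, Y) < n" if "u \<in> VH" "s < m" "Y \<in> even_subsets k" for u s Y
    using lab_range that by force
  have "x < n \<and> y < n \<and> x \<noteq> y" if xy: "(x, y) \<in> edges \<sigma> R" for x y
  proof -
    obtain u v s Y where A: "x = lab (u, s, Y)" "y = lab (v, target \<sigma> u v s, Y)"
      "(u, v) \<in> EH" "s < m" "Y \<in> even_subsets k"
      using xy unfolding edges_def by auto
    then show ?thesis
      using * EH_D target_less[OF assms] lab_eq_iff EH_irrefl by metis
  qed
  then show ?thesis unfolding digraph_on_def by fastforce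
qed

text \<open>Neighbours of a copy of u come from the neighbours of u in H. For indegrees this uses
  that each \<open>\<sigma> i\<close> with i < k is a permutation: a predecessor u of v in H enters
  a given copy of v only from the location found by \<open>inv\<close>.\<close>

lemma d_bounded_edges:
  assumes "\<sigma> \<in> matchings k m"
  shows "d_bounded (edges \<sigma> R) d"
  unfolding d_bounded_def
proof (intro allI conjI)
  fix x
  have out: "card {v. (u, v) \<in> EH} \<le> d" and inn: "card {v. (v, u) \<in> EH} \<le> d" for u
    using EH_bounded unfolding d_bounded_def by auto
  have fin: "finite {v. (u, v) \<in> EH}" "finite {v. (v, u) \<in> EH}" for u
    by (rule finite_subset[OF _ finite_VH], use EH_sub in blast)+
  show "card {y. (x, y) \<in> edges \<sigma> R} \<le> d"
  proof (cases "{y. (x, y) \<in> edges \<sigma> R} = {}")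
    case False
    then obtain u s Y where x: "x = lab (u, s, Y)" "u \<in> VH" "s < m" "Y \<in> even_subsets k"
      unfolding edges_def using EH_D by blast
    have "{y. (x, y) \<in> edges \<sigma> R} = edges \<sigma> R `` {lab (u, s, Y)}" using x(1) by auto
    also have "\<dots> \<subseteq> (\<lambda>v. lab (v, target \<sigma> u v s, Y)) ` {v. (u, v) \<in> EH}"
      unfolding edges_nbrs[OF x(2-4)] by auto
    finally have "card {y. (x, y) \<in> edges \<sigma> R} \<le> card {v. (u, v) \<in> EH}"
      using fin by (meson surj_card_le)
    then show ?thesis using out[of u] by simp
  qed simp
  show "card {y. (y, x) \<in> edges \<sigma> R} \<le> d"
  proof (cases "{y. (y, x) \<in> edges \<sigma> R} = {}")
    case False
    then obtain v s Y where x: "x = lab (v, s, Y)" "v \<in> VH" "s < m" "Y \<in> even_subsets k"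
      unfolding edges_def using EH_D target_less[OF assms] by blast
    have "{y. (y, x) \<in> edges \<sigma> R} \<subseteq>
      (\<lambda>u. lab (u, if part u = part v then s else inv (\<sigma> (part u)) s, Y)) ` {u. (u, v) \<in> EH}"
    proof
      fix y assume "y \<in> {y. (y, x) \<in> edges \<sigma> R}"
      then obtain u v' s' Y' where A: "y = lab (u, s', Y')" "x = lab (v', target \<sigma> u v' s', Y')"
        "(u, v') \<in> EH" "s' < m" "Y' \<in> even_subsets k"
        unfolding edges_def by auto
      have eq: "v = v' \<and> s = target \<sigma> u v' s' \<and> Y = Y'"
        using lab_eq_iff[OF x(2-4), of v' "target \<sigma> u v' s'" Y'] A x(1) EH_D target_less[OF assms A(3,4)] by auto
      have "s' = (if part u = part v then s else inv (\<sigma> (part u)) s)"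
        using eq part_edge[OF A(3)] matchingsD[OF assms, of "part u"]
        unfolding target_def by (auto simp: permutes_inverses)
      then show "y \<in> (\<lambda>u. lab (u, if part u = part v then s else inv (\<sigma> (part u)) s, Y)) ` {u. (u, v) \<in> EH}"
        using A eq by auto
    qed
    then have "card {y. (y, x) \<in> edges \<sigma> R} \<le> card {u. (u, v) \<in> EH}"
      using fin by (meson surj_card_le)
    then show ?thesis using inn[of v] by simp
  qed simp
qed

text \<open>The index Y is dropped because all copies at one location share their gadget and bit.
  Core vertices have no location, since their outgoing edges stay in the core and reveal no
  secret.\<close>

definition source_copy :: "nat \<Rightarrow> (nat \<times> nat) option" where
  "source_copy x = (if x \<in> lab ` (VH \<times> {..<m} \<times> even_subsets k)
     then (case inv_into (VH \<times> {..<m} \<times> even_subsets k) lab x of (u, s, Y) \<Rightarrow>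
        if part u < k then Some (part u, s) else None) else None)"

lemma source_copy_lab:
  assumes "u \<in> VH" "s < m" "Y \<in> even_subsets k"
  shows "source_copy (lab (u, s, Y)) = (if part u < k then Some (part u, s) else None)"
  using assms lab_inj unfolding source_copy_def by auto

text \<open>This is where the unidirectional model enters: every edge between a source component and
  the core leaves the source component, so it is visible only from there. Sorted lists make the
  answers at x a function of its out-neighbourhood alone.\<close>

sublocale hidden_matching k m source_copy "\<lambda>\<sigma> R. adj_list (edges \<sigma> R)"
proof
  show "0 < k" using k_ge by simp
  show "i < k \<and> s < m" if "source_copy x = Some (i, s)" for x i s
  proof (cases "x \<in> lab ` (VH \<times> {..<m} \<times> even_subsets k)")
    case True
    then obtain u s' Y where "x = lab (u, s', Y)" "u \<in> VH" "s' < m" "Y \<in> even_subsets k" by auto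
    then show ?thesis using that source_copy_lab[of u s' Y] by (auto split: if_splits)
  qed (use that in \<open>simp add: source_copy_def\<close>)
  fix x R R' and \<sigma> \<sigma>' :: "nat \<Rightarrow> nat \<Rightarrow> nat"
  assume A: "\<And>i s. source_copy x = Some (i, s) \<Longrightarrow> \<sigma> i s = \<sigma>' i s \<and> ((\<sigma> i s, i) \<in> R \<longleftrightarrow> (\<sigma> i s, i) \<in> R')"
  have "edges \<sigma> R `` {x} = edges \<sigma>' R' `` {x}"
  proof (cases "x \<in> lab ` (VH \<times> {..<m} \<times> even_subsets k)")
    case True
    then obtain u s Y where x: "x = lab (u, s, Y)" "u \<in> VH" "s < m" "Y \<in> even_subsets k" by auto
    have "target \<sigma> u v s = target \<sigma>' u v s \<and> (part u \<noteq> part v \<longrightarrow> attached \<sigma> R u s Y = attached \<sigma>' R' u s Y)"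
      if "(u, v) \<in> EH" for v
      using A[of "part u" s] part_edge[OF that] unfolding x(1) source_copy_lab[OF x(2-4)] target_def attached_def
      by auto
    then show ?thesis unfolding x(1) edges_nbrs[OF x(2-4)] by (intro image_cong) auto
  next
    case False
    then have "edges \<sigma> R `` {x} = {}" for \<sigma> R
      unfolding edges_def using EH_D by force
    then show ?thesis by simp
  qed
  then show "adj_list (edges \<sigma> R) x = adj_list (edges \<sigma>' R') x"
    unfolding adj_list_def by (intro ext) simp
qed

section \<open>Even inputs are far, odd inputs are H-free\<close>

lemma config_section: "R \<in> configs k m b \<Longrightarrow> R `` {j} \<subseteq> {..<k}"
  unfolding configs_def by blast

text \<open>In an even configuration the row of j is itself one of the sets Y, and the copy with
  this index is complete at gadget j. The m copies obtained in this way are vertex disjoint, so an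
  H-free digraph misses an edge of each, and these edges are distinct.\<close>

lemma edges_far:
  assumes \<sigma>: "\<sigma> \<in> matchings k m" and R: "R \<in> configs k m True"
    and E': "H_free n E' VH EH"
  shows "m \<le> card (edges \<sigma> R - E')"
proof -
  define f where "f j v = lab (v, if part v < k then inv (\<sigma> (part v)) j else j, R `` {j})" for j v
  have Y: "R `` {j} \<in> even_subsets k" if "j < m" for j
    using R that unfolding configs_def even_subsets_def by blast
  have s: "(if part v < k then inv (\<sigma> (part v)) j else j) < m" if "j < m" for j v
    using permutes_in_image[OF permutes_inv[OF matchingsD[OF \<sigma>]], of "part v" j] that by auto
  have f_inj: "v = v' \<and> j = j'" if "f j v = f j' v'" "v \<in> VH" "v' \<in> VH" "j < m" "j' < m" for j j' v v'
  proof -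
    have eq: "v = v'" "(if part v < k then inv (\<sigma> (part v)) j else j) = (if part v' < k then inv (\<sigma> (part v')) j' else j')"
      using lab_eq_iff[OF that(2) s[OF that(4)] Y[OF that(4)] that(3) s[OF that(5)] Y[OF that(5)]] that(1)
      unfolding f_def by blast+
    show ?thesis
    proof (cases "part v < k")
      case True
      then show ?thesis using eq permutes_inverses(1)[OF matchingsD[OF \<sigma> True]] by metis
    qed (use eq in auto)
  qed
  have f_edge: "(f j u, f j v) \<in> edges \<sigma> R" if "(u, v) \<in> EH" "j < m" for j u v
  proof -
    define s0 where "s0 = (if part u < k then inv (\<sigma> (part u)) j else j)"
    have "f j u = lab (u, s0, R `` {j})" unfolding f_def s0_def by simp
    moreover have "f j v = lab (v, target \<sigma> u v s0, R `` {j})"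
      using part_edge[OF that(1)] permutes_inverses(1)[OF matchingsD[OF \<sigma>], of "part u"]
      unfolding f_def s0_def target_def by auto
    moreover have "part u \<noteq> part v \<longrightarrow> attached \<sigma> R u s0 (R `` {j})"
      using part_edge[OF that(1)] permutes_inverses(1)[OF matchingsD[OF \<sigma>], of "part u"]
      unfolding s0_def attached_def by auto
    moreover have "s0 < m" unfolding s0_def using s[OF that(2)] by simp
    ultimately show ?thesis unfolding edges_def using that(1) Y[OF that(2)] by blast
  qed
  have "\<exists>e. e \<in> EH \<and> (f j (fst e), f j (snd e)) \<notin> E'" if "j < m" for j
  proof -
    have "inj_on (f j) VH" using f_inj that by (auto intro!: inj_onI)
    moreover have "f j ` VH \<subseteq> {0..<n}"
      using lab_range s[OF that] Y[OF that] unfolding f_def by blast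
    ultimately have "\<not> (\<forall>(a, b)\<in>EH. (f j a, f j b) \<in> E')"
      using E' unfolding H_free_def contains_subgraph_def by blast
    then show ?thesis by force
  qed
  then obtain e where e: "e j \<in> EH" "(f j (fst (e j)), f j (snd (e j))) \<notin> E'" if "j < m" for j
    by metis
  define g where "g j = (f j (fst (e j)), f j (snd (e j)))" for j
  have "inj_on g {..<m}"
  proof (rule inj_onI)
    fix i j assume "i \<in> {..<m}" "j \<in> {..<m}" "g i = g j"
    then show "i = j"
      using f_inj[of i "fst (e i)" j "fst (e j)"] e(1)[of i] e(1)[of j] EH_sub unfolding g_def by fastforce
  qed
  moreover have "g ` {..<m} \<subseteq> edges \<sigma> R - E'"
    using e f_edge unfolding g_def by force
  moreover have "finite (edges \<sigma> R - E')"
    using digraph_on_edges[OF \<sigma>, of R] finite_subset[of "edges \<sigma> R" "{0..<n} \<times> {0..<n}"] unfolding digraph_on_def by auto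
  ultimately show ?thesis using card_inj_on_le by fastforce
qed

text \<open>A copy of H is weakly connected, so all its vertices share one key. Within one key every
  vertex of H occurs at most once, so by counting the copy uses every vertex of H, in particular all
  source components, attached to one core. Then Y is the row of j, although one is even and the
  other odd.\<close>

lemma edges_H_free:
  assumes \<sigma>: "\<sigma> \<in> matchings k m" and R: "R \<in> configs k m False"
  shows "H_free n (edges \<sigma> R) VH EH"
  unfolding H_free_def contains_subgraph_def
proof (rule notI, elim exE conjE)
  fix f assume f: "inj_on f VH" "\<forall>(a, b)\<in>EH. (f a, f b) \<in> edges \<sigma> R"
  \<comment> \<open>An invariant of the weak components: the core a vertex is attached to, or else
    the source copy that it lies in.\<close>
  define key where "key u s Y = (if part u < k then if attached \<sigma> R u s Y then (k, \<sigma> (part u) s, Y) else (part u, s, Y)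
    else (k, s, Y))" for u s Y
  define sits where "sits x u \<kappa> \<longleftrightarrow> (\<exists>s Y. u \<in> VH \<and> s < m \<and> Y \<in> even_subsets k \<and> x = lab (u, s, Y) \<and> key u s Y = \<kappa>)"
    for x u \<kappa>
  have sits_edge: "\<exists>u v \<kappa>. sits x u \<kappa> \<and> sits y v \<kappa>" if xy: "(x, y) \<in> edges \<sigma> R" for x y
  proof -
    obtain u v s Y where A: "x = lab (u, s, Y)" "y = lab (v, target \<sigma> u v s, Y)"
      "(u, v) \<in> EH" "s < m" "Y \<in> even_subsets k" "part u \<noteq> part v \<longrightarrow> attached \<sigma> R u s Y"
      using xy unfolding edges_def by auto
    have "key u s Y = key v (target \<sigma> u v s) Y"
      using part_edge[OF A(3)] A(6) unfolding key_def target_def attached_def by auto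
    then show ?thesis using A EH_D target_less[OF \<sigma> A(3,4)] unfolding sits_def by blast
  qed
  have sits_unique: "u = u' \<and> \<kappa> = \<kappa>'" if "sits x u \<kappa>" "sits x u' \<kappa>'" for x u u' \<kappa> \<kappa>'
    using that lab_eq_iff unfolding sits_def by metis
  have sits_inj: "x = x'" if xx: "sits x u \<kappa>" "sits x' u \<kappa>" for x x' u \<kappa>
  proof -
    obtain s Y s' Y' where "x = lab (u, s, Y)" "key u s Y = \<kappa>" "x' = lab (u, s', Y')" "key u s' Y' = \<kappa>"
      using xx unfolding sits_def by auto
    moreover from this have "s = s' \<and> Y = Y'"
      using permutes_inj[OF matchingsD[OF \<sigma>], of "part u"] unfolding key_def
      by (auto split: if_splits dest: injD)
    ultimately show ?thesis by simp
  qed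
  \<comment> \<open>As k >= 2, H has two distinct vertices and hence an edge at a; this makes
    \<open>f a\<close> a labelled vertex with a key.\<close>
  obtain a b where ab: "a \<in> VH" "b \<in> VH" "a \<noteq> b"
    using part_surj[of 0] part_surj[of 1] k_ge by force
  then have "(a, b) \<in> (EH \<union> EH\<inverse>)\<^sup>*" using connected unfolding weakly_connected_def by auto
  then obtain c where "(a, c) \<in> EH \<union> EH\<inverse>" using ab(3) by (meson converse_rtranclE)
  then obtain u0 \<kappa> where u0: "sits (f a) u0 \<kappa>" using f(2) sits_edge by blast
  have all: "\<exists>u. sits (f v) u \<kappa>" if "v \<in> VH" for v
  proof -
    have "(a, v) \<in> (EH \<union> EH\<inverse>)\<^sup>*" using connected that ab unfolding weakly_connected_def by auto
    then show ?thesis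
    proof induction
      case base
      then show ?case using u0 by blast
    next
      case (step y z)
      then have "(f y, f z) \<in> edges \<sigma> R \<or> (f z, f y) \<in> edges \<sigma> R" using f(2) by auto
      then show ?case using sits_edge sits_unique step.IH by metis
    qed
  qed
  then obtain g where g: "sits (f v) (g v) \<kappa>" if "v \<in> VH" for v by metis
  have "inj_on g VH"
    using g sits_inj f(1) by (metis inj_on_def)
  moreover have "g ` VH \<subseteq> VH" using g unfolding sits_def by auto
  ultimately have surj: "g ` VH = VH" using finite_VH by (simp add: endo_inj_surj)
  obtain i j Y where \<kappa>: "\<kappa> = (i, j, Y)" by (cases \<kappa>)
  have ex: "\<exists>s<m. Y \<in> even_subsets k \<and> key u s Y = \<kappa>" if u: "u \<in> VH" for u
  proof -
    obtain v where "v \<in> VH" "u = g v" using u surj by auto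
    then obtain s Y' where "s < m" "Y' \<in> even_subsets k" "key u s Y' = \<kappa>" using g unfolding sits_def by blast
    moreover from this have "Y' = Y" unfolding key_def \<kappa> by (auto split: if_splits)
    ultimately show ?thesis by blast
  qed
  have Y: "Y \<in> even_subsets k" using ex ab by blast
  \<comment> \<open>The key of a detached source copy only admits vertices of a single part, whereas
    H has parts 0 and 1.\<close>
  have "i = k"
  proof (rule ccontr)
    assume "i \<noteq> k"
    then have "part u = i" if "u \<in> VH" for u using ex[OF that] unfolding key_def \<kappa> by (auto split: if_splits)
    then show False using part_surj[of 0] part_surj[of 1] k_ge by force
  qed
  have iff: "i' \<in> Y \<longleftrightarrow> (j, i') \<in> R" and jm: "j < m" if i': "i' < k" for i'
  proof -
    obtain u where u: "u \<in> VH" "part u = i'" using part_surj[OF i'] by auto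
    then obtain s where s: "s < m" "key u s Y = \<kappa>" using ex by blast
    then have "attached \<sigma> R u s Y" "\<sigma> i' s = j" using u that \<open>i = k\<close> unfolding key_def \<kappa> by (auto split: if_splits)
    then show "i' \<in> Y \<longleftrightarrow> (j, i') \<in> R" unfolding attached_def using u by simp
    show "j < m" using \<open>\<sigma> i' s = j\<close> permutes_in_image[OF matchingsD[OF \<sigma> that], of s] s by auto
  qed
  have "R `` {j} = Y" using iff config_section[OF R, of j] Y unfolding even_subsets_def by blast
  moreover have "odd (card (R `` {j}))" using R jm[of 0] k_ge unfolding configs_def by auto
  ultimately show False using Y unfolding even_subsets_def by auto
qed

text \<open>Fewer than q queries on every valid input means at most the floor of q, and the bound on
  \<open>eps\<close> turns the m missing edges of \<open>edges_far\<close> into farness.\<close>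

lemma query_bound_of_tester:
  fixes T :: "qtree pmf"
  assumes T: "is_tester n d eps VH EH T" and eps: "eps * real d * real n < real m"
    and few: "\<not> needs_queries n d T q"
  shows "real (m - nat \<lfloor>q\<rfloor>) ^ k \<le> 3 * real m * real (nat \<lfloor>q\<rfloor>) ^ k"
proof (rule tester_queries_ge)
  note valid = digraph_on_edges d_bounded_edges represents_adj_list[OF digraph_on_edges d_bounded_edges]
  fix \<sigma> R assume \<sigma>: "\<sigma> \<in> matchings k m"
  show "2/3 \<le> measure_pmf.prob T {t. run (adj_list (edges \<sigma> R)) t}" if "R \<in> configs k m False"
    using T valid[OF \<sigma>] valid(3)[OF \<sigma> \<sigma>] edges_H_free[OF \<sigma> that] unfolding is_tester_def by blast
  show "2/3 \<le> measure_pmf.prob T {t. \<not> run (adj_list (edges \<sigma> R)) t}" if "R \<in> configs k m True"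
  proof -
    have "eps_far n d eps (edges \<sigma> R) VH EH"
      unfolding eps_far_def
    proof (intro allI impI)
      fix E' assume E': "digraph_on n E' \<and> d_bounded E' d \<and> H_free n E' VH EH"
      have fin: "finite E" if "digraph_on n E" for E
        using that finite_subset[of E "{0..<n} \<times> {0..<n}"] unfolding digraph_on_def by auto
      have "m \<le> card (edges \<sigma> R - E')" using edges_far[OF \<sigma> that] E' by blast
      also have "\<dots> \<le> card ((edges \<sigma> R - E') \<union> (E' - edges \<sigma> R))"
        using fin E' valid(1)[OF \<sigma>] by (intro card_mono) auto
      finally show "eps * real d * real n < real (card ((edges \<sigma> R - E') \<union> (E' - edges \<sigma> R)))"
        using eps by linarith
    qed
    then show ?thesis using T valid(1,2)[OF \<sigma>] valid(3)[OF \<sigma> \<sigma>] unfolding is_tester_def by blast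
  qed
  show "num_queries (adj_list (edges \<sigma> R)) t \<le> nat \<lfloor>q\<rfloor>" if "t \<in> set_pmf T" for t
  proof -
    have "real (num_queries (adj_list (edges \<sigma> R)) t) < q"
      using few valid(1,2)[OF \<sigma>] valid(3)[OF \<sigma> \<sigma>] that unfolding needs_queries_def by (meson not_le)
    then show ?thesis by linarith
  qed
qed

end

section \<open>The lower bound\<close>

lemma source_component_disjoint:
  assumes "is_source_component V E W" "is_source_component V E W'" "x \<in> W" "x \<in> W'"
  shows "W = W'"
proof -
  \<comment> \<open>A source component contains every vertex that can reach it, in particular every
    strongly connected set meeting it.\<close>
  have sub: "B \<subseteq> A" if AB: "is_source_component V E A" "is_source_component V E B" "x \<in> A" "x \<in> B" for A B
  proof
    fix b assume "b \<in> B"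
    then have "(b, x) \<in> (E \<inter> B \<times> B)\<^sup>*"
      using AB unfolding is_source_component_def is_scc_def strongly_conn_set_def by blast
    then show "b \<in> A"
    proof (induction rule: converse_rtrancl_induct)
      case base
      show ?case using AB by simp
    next
      case (step y z)
      then show ?case using AB(1) unfolding is_source_component_def by blast
    qed
  qed
  show ?thesis using sub[of W W'] sub[of W' W] assms by blast
qed

lemma ex_source_partition:
  assumes "0 < k" "num_source_components V E = k"
  shows "\<exists>part. (\<forall>u v. (u, v) \<in> E \<longrightarrow> part u \<noteq> part v \<longrightarrow> part u < k \<and> part v = k) \<and>
                (\<forall>i<k. \<exists>u\<in>V. part u = i)"
proof -
  define S where "S = {W. is_source_component V E W}"
  have "card S = k" using assms(2) unfolding S_def num_source_components_def .
  \<comment> \<open>An infinite set has cardinality 0, so k > 0 gives finiteness.\<close>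
  moreover from this assms(1) have "finite S" using card.infinite by fastforce
  ultimately obtain e where e: "bij_betw e {0..<k} S" using ex_bij_betw_nat_finite by blast
  have src: "is_source_component V E (e i)" if "i < k" for i
    using bij_betwE[OF e] that unfolding S_def by auto
  define part where "part u = (if \<exists>i<k. u \<in> e i then SOME i. i < k \<and> u \<in> e i else k)" for u
  have part_mem: "part u < k \<and> u \<in> e (part u)" if "\<exists>i<k. u \<in> e i" for u
    using someI_ex[OF that] that unfolding part_def by simp
  have part_eq: "part u = i" if "i < k" "u \<in> e i" for u i
  proof -
    have P: "part u < k \<and> u \<in> e (part u)" using part_mem that by blast
    then have "e (part u) = e i" using source_component_disjoint[OF src src[OF that(1)] _ that(2)] by simp
    then show ?thesis using bij_betw_imp_inj_on[OF e] P that by (auto dest: inj_onD)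
  qed
  have "part u < k \<and> part v = k" if uv: "(u, v) \<in> E" "part u \<noteq> part v" for u v
  proof (cases "\<exists>i<k. v \<in> e i")
    case True
    then obtain i where i: "i < k" "v \<in> e i" by blast
    then have "u \<in> e i" using src[OF i(1)] uv(1) unfolding is_source_component_def by blast
    then show ?thesis using part_eq i uv(2) by simp
  next
    case False
    then have v: "part v = k" unfolding part_def by (simp only: if_False)
    have "\<exists>i<k. u \<in> e i"
    proof (rule ccontr)
      assume "\<not> ?thesis"
      then have "part u = k" unfolding part_def by (simp only: if_False)
      then show False using uv(2) v by simp
    qed
    then show ?thesis using part_mem v by blast
  qed
  moreover have "\<exists>u\<in>V. part u = i" if "i < k" for i
    using src[OF that] part_eq[OF that] unfolding is_source_component_def is_scc_def by blast
  ultimately show ?thesis by blast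
qed

section \<open>Choice of the constants\<close>

lemma query_count_bound_false:
  fixes K m n k :: nat and q :: real
  assumes "2 \<le> k" "0 < K" "0 < m" "n \<le> 2 * K * m"
    and q: "q = 1 / (8 * real K) * real n powr (1 - 1 / real k)"
    and le: "real (m - nat \<lfloor>q\<rfloor>) ^ k \<le> 3 * real m * real (nat \<lfloor>q\<rfloor>) ^ k"
  shows False
proof -
  define r where "r = nat \<lfloor>q\<rfloor>"
  have q0: "0 \<le> q" unfolding q by simp
  have rq: "real r \<le> q" unfolding r_def using q0 by simp
  have nle: "real n \<le> 2 * real K * real m" using assms(4) by (metis of_nat_le_iff of_nat_mult of_nat_numeral)
  have "real n powr (1 - 1 / real k) \<le> real n"
  proof (cases "n = 0")
    case False
    then have "real n powr (1 - 1 / real k) \<le> real n powr 1"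
      by (intro powr_mono) auto
    then show ?thesis using False by simp
  qed simp
  \<comment> \<open>The factor 1/(8K) together with n <= 2Km gives q <= m/4, hence m - r >=
    m/2.\<close>
  then have "q \<le> 1 / (8 * real K) * (2 * real K * real m)"
    unfolding q using nle by (intro mult_left_mono) auto
  also have "\<dots> = real m / 4" using assms(2) by simp
  finally have "real r \<le> real m / 4" using rq by simp
  then have mr: "real m / 2 \<le> real (m - r)" by linarith
  have "(real n powr (1 - 1 / real k)) ^ k = real n ^ (k - 1)"
  proof (cases "n = 0")
    case False
    then have "(real n powr (1 - 1 / real k)) ^ k = real n powr ((1 - 1 / real k) * real k)"
      by (simp add: powr_powr flip: powr_realpow)
    also have "(1 - 1 / real k) * real k = real (k - 1)" using assms(1) by (simp add: field_simps)
    also have "real n powr real (k - 1) = real n ^ (k - 1)" using False by (simp add: powr_realpow)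
    finally show ?thesis .
  qed (use assms(1) in \<open>simp add: power_0_left\<close>)
  then have qk: "q ^ k = (1 / (8 * real K)) ^ k * real n ^ (k - 1)"
    unfolding q by (simp only: power_mult_distrib)
  \<comment> \<open>The power q^k carries n^(k-1); one more factor 2Km fills it up to exponent k,
    and K >= 1 then gives 2 m q^k <= (m/4)^k.\<close>
  have "2 * real K * real m * q ^ k \<le> 2 * real K * real m * ((1 / (8 * real K)) ^ k * (2 * real K * real m) ^ (k - 1))"
    unfolding qk using nle by (intro mult_left_mono power_mono) auto
  also have "\<dots> = (1 / (8 * real K)) ^ k * (2 * real K * real m) ^ k"
    using assms(1) by (cases k) auto
  also have "\<dots> = (real m / 4) ^ k"
    unfolding power_mult_distrib[symmetric] using assms(2) by (simp add: field_simps)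
  finally have A: "2 * real K * real m * q ^ k \<le> (real m / 4) ^ k" .
  have rk: "real r ^ k \<le> q ^ k" using rq by (intro power_mono) auto
  have "2 * real m * q ^ k \<le> 2 * real K * real m * q ^ k"
    using assms(2) q0 by (intro mult_right_mono) auto
  then have B: "2 * (real m * q ^ k) \<le> (real m / 4) ^ k" using A by simp
  \<comment> \<open>As k >= 2, (m/2)^k is at least 4 (m/4)^k, whereas 3 m q^k is at most 3/2
    (m/4)^k.\<close>
  have "4 * (real m / 4) ^ k \<le> 2 ^ k * (real m / 4) ^ k"
    using power_increasing[OF assms(1), of "2::real"] by (intro mult_right_mono) auto
  also have "\<dots> = (real m / 2) ^ k" by (simp flip: power_mult_distrib)
  also have "\<dots> \<le> real (m - r) ^ k" using mr by (intro power_mono) auto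
  also have "\<dots> \<le> 3 * real m * real r ^ k" using le unfolding r_def .
  also have "\<dots> \<le> 3 * real m * q ^ k" using rk by (intro mult_left_mono) auto
  finally have "4 * (real m / 4) ^ k \<le> 3 * (real m * q ^ k)" by simp
  moreover have "0 < (real m / 4) ^ k" using assms(3) by simp
  ultimately show False using B by linarith
qed

theorem theorem2:
  fixes k d :: nat and VH :: "'a set" and EH :: "('a \<times> 'a) set"
  assumes "k \<ge> 2"
    and "finite VH" and "EH \<subseteq> VH \<times> VH" and "\<forall>a. (a, a) \<notin> EH"
    and "d_bounded EH d"
    and "weakly_connected VH EH"
    and "num_source_components VH EH = k"
  shows "\<exists>eps0 > 0. \<exists>c > 0. \<exists>N. \<forall>n \<ge> N. \<forall>T.
           is_tester n d eps0 VH EH T \<longrightarrow> needs_queries n d T (c * real n powr (1 - 1 / real k))"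
proof -
  obtain part where part: "\<And>u v. (u, v) \<in> EH \<Longrightarrow> part u \<noteq> part v \<Longrightarrow> part u < k \<and> part v = k"
    "\<And>i. i < k \<Longrightarrow> \<exists>u\<in>VH. part u = i"
    using ex_source_partition[OF _ assms(7)] assms(1) by auto
  \<comment> \<open>The number of vertices of one gadget.\<close>
  define K where "K = card (VH \<times> even_subsets k)"
  have fin: "finite (even_subsets k)"
    unfolding even_subsets_def by (rule finite_subset[of _ "Pow {..<k}"]) auto
  have "{} \<in> even_subsets k" unfolding even_subsets_def by simp
  moreover have "VH \<noteq> {}" using assms(6) unfolding weakly_connected_def by simp
  ultimately have K: "0 < K" unfolding K_def using fin assms(2) by (auto simp: card_gt_0_iff)
  \<comment> \<open>Since n <= 2Km, this makes \<open>eps * d * n\<close> at most m/2; the summand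
    in \<open>d + 1\<close> keeps \<open>eps\<close> positive for d = 0.\<close>
  define eps where "eps = 1 / (4 * real K * real (d + 1))"
  define c where "c = 1 / (8 * real K)"
  have "needs_queries n d T (c * real n powr (1 - 1 / real k))"
    if n: "K \<le> n" and T: "is_tester n d eps VH EH T" for n T
  proof (rule ccontr)
    assume few: "\<not> needs_queries n d T (c * real n powr (1 - 1 / real k))"
    \<comment> \<open>As many gadgets as fit. The fewer than K remaining vertices stay isolated, and
      n >= K makes m positive.\<close>
    define m where "m = n div K"
    have m: "0 < m" unfolding m_def using n K by (simp add: div_greater_zero_iff)
    have "n = K * m + n mod K" unfolding m_def by simp
    also have "n mod K \<le> K * m"
    proof -
      have "n mod K \<le> K * 1" using mod_less_divisor[OF K, of n] by simp
      also have "\<dots> \<le> K * m" using m by (intro mult_le_mono2) simp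
      finally show ?thesis .
    qed
    finally have nm: "n \<le> 2 * K * m" by simp
    then have nm_real: "real n \<le> 2 * real K * real m"
      by (metis of_nat_le_iff of_nat_mult of_nat_numeral)
    have "card (VH \<times> {..<m} \<times> even_subsets k) = m * K"
      unfolding K_def by (simp add: card_cartesian_product)
    also have "\<dots> \<le> n" unfolding m_def by simp
    finally have "card (VH \<times> {..<m} \<times> even_subsets k) \<le> card {0..<n}" by simp
    then obtain lab where lab: "lab ` (VH \<times> {..<m} \<times> even_subsets k) \<subseteq> {0..<n}"
      "inj_on lab (VH \<times> {..<m} \<times> even_subsets k)"
      using card_le_inj[of "VH \<times> {..<m} \<times> even_subsets k" "{0..<n}"] fin assms(2) by auto
    interpret gadget_digraph VH EH part k d m n lab
      by unfold_locales (use assms part lab in auto)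
    have "eps * real d * real n \<le> 1 / (4 * real K * real (d + 1)) * real (d + 1) * (2 * real K * real m)"
      unfolding eps_def using nm_real by (intro mult_mono) auto
    also have "\<dots> = real m / 2" using K by (simp del: of_nat_add)
    finally have "eps * real d * real n < real m" using m by simp
    from query_bound_of_tester[OF T this few] show False
      using query_count_bound_false[OF assms(1) K m nm refl] unfolding c_def by simp
  qed
  moreover have "0 < eps" "0 < c" unfolding eps_def c_def using K by simp_all
  ultimately show ?thesis by blast
qed

end
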